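(* For $n\ge1$ and $r\ge1$, the number of (nonempty) partitions of perimeter $2n+2$ and rank $r$ equals $\binom{n}{2r-1}$.
   Context: For a nonempty partition $\lambda$, its perimeter is $2(\lambda_1+\ell(\lambda))$, where $\lambda_1$ is the largest part and $\ell(\lambda)$ the number of parts (i.e. the boundary length of its Young diagram). Its rank is the Durfee rank, i.e. the largest $r$ with $\lambda_r\ge r$ (the number of cells on the main diagonal of its Young diagram). *)

theory Defs
  imports Main
begin

definition is_partition :: "nat list \<Rightarrow> bool" where
  "is_partition xs \<longleftrightarrow> sorted_wrt (\<ge>) xs \<and> (\<forall>x\<in>set xs. 0 < x)"

text \<open>Since the parts are listed in weakly decreasing order, \<open>hd xs\<close> is the largest part; both
  functions below are only meaningful for nonempty partitions.\<close>

definition perimeter :: "nat list \<Rightarrow> nat" where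
  "perimeter xs = 2 * (hd xs + length xs)"

text \<open>Lists are indexed from 0, so the \<open>i\<close>-th part is \<open>xs ! (i - 1)\<close>.\<close>

definition durfee_rank :: "nat list \<Rightarrow> nat" where
  "durfee_rank xs = Max {i \<in> {1..length xs}. xs ! (i - 1) \<ge> i}"

end

theory Submission
  imports Defs
begin

text \<open>
  Deleting the first row and the first column of the Young diagram of a partition \<open>\<lambda>\<close> lowers the
  rank by one. Conversely, \<open>\<lambda>\<close> is recovered from the remaining partition \<open>\<mu>\<close> together with the
  number \<open>i\<close> of cells by which the first row of \<open>\<lambda>\<close> overhangs, and the number \<open>j\<close> of cells by
  which the first column does; the semiperimeter then grows by \<open>i + j + 2\<close>. Hence the number
  \<open>c\<^sub>r(m)\<close> of partitions of rank \<open>r\<close> and semiperimeter \<open>m\<close> satisfies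
  \<open>c\<^sub>r\<^sub>+\<^sub>1(m + 2) = (\<Sum>k\<le>m. c\<^sub>r(k) (m - k + 1))\<close>, starting from the empty partition for \<open>r = 0\<close>,
  and the binomial coefficients solve this recurrence.
\<close>

text \<open>The value 0 on \<open>[]\<close> lets the empty partition be the base of the
  recursion.\<close>

definition max_part :: "nat list \<Rightarrow> nat" where
  "max_part xs = (if xs = [] then 0 else hd xs)"

definition semiperimeter :: "nat list \<Rightarrow> nat" where
  "semiperimeter xs = max_part xs + length xs"

text \<open>Unlike \<^const>\<open>durfee_rank\<close>, which is the maximum of an empty set on \<open>[]\<close>, this is \<open>0\<close> there.\<close>

definition diagonal_length :: "nat list \<Rightarrow> nat" where
  "diagonal_length xs = card {i. i < length xs \<and> i < xs ! i}"

text \<open>\<open>Suc\<close> accounts for the cells of the new first column in the old rows, and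
  \<open>replicate j 1\<close> for its overhang below them.\<close>

definition add_hook :: "nat list \<Rightarrow> nat \<Rightarrow> nat \<Rightarrow> nat list" where
  "add_hook xs i j = Suc (max_part xs + i) # map Suc xs @ replicate j 1"

definition partitions_by_rank :: "nat \<Rightarrow> nat \<Rightarrow> nat list set" where
  "partitions_by_rank r m =
     {xs. is_partition xs \<and> semiperimeter xs = m \<and> diagonal_length xs = r}"

lemma durfee_rank_eq_diagonal_length:
  assumes "is_partition xs" "xs \<noteq> []"
  shows "durfee_rank xs = diagonal_length xs"
proof -
  define D where "D = {i \<in> {1..length xs}. xs ! (i - 1) \<ge> i}"
  have fin: "finite D" by (simp add: D_def)
  have "xs ! 0 > 0" using assms by (auto simp: is_partition_def)
  then have "1 \<in> D" using assms(2) by (auto simp: D_def Suc_le_eq)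
  then have Max_in: "Max D \<in> D" using fin Max_in by blast
  have "i \<in> D" if "1 \<le> i" "i \<le> Max D" for i
  proof -
    have "xs ! (Max D - 1) \<le> xs ! (i - 1)"
    proof (cases "i = Max D")
      case False
      then show ?thesis
        using that Max_in assms(1)
        by (intro sorted_wrt_nth_less[where P = "(\<ge>)"]) (auto simp: is_partition_def D_def)
    qed simp
    then show ?thesis using that Max_in by (auto simp: D_def)
  qed
  then have "{1..Max D} \<subseteq> D" by auto
  moreover have "D \<subseteq> {1..Max D}"
  proof
    fix i assume "i \<in> D"
    then show "i \<in> {1..Max D}" using Max_ge[OF fin] by (auto simp: D_def)
  qed
  ultimately have "card D = card {1..Max D}" by (metis subset_antisym)
  then have "card D = Max D" by simp
  moreover have "D = Suc ` {i. i < length xs \<and> i < xs ! i}"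
  proof (rule set_eqI)
    fix i
    show "i \<in> D \<longleftrightarrow> i \<in> Suc ` {i. i < length xs \<and> i < xs ! i}"
      by (cases i) (auto simp: D_def)
  qed
  ultimately show ?thesis
    unfolding durfee_rank_def D_def[symmetric] diagonal_length_def by (metis card_image inj_Suc)
qed

section \<open>Adding and removing a hook\<close>

lemma semiperimeter_add_hook: "semiperimeter (add_hook xs i j) = semiperimeter xs + i + j + 2"
  by (simp add: semiperimeter_def add_hook_def max_part_def)

lemma diagonal_length_add_hook: "diagonal_length (add_hook xs i j) = Suc (diagonal_length xs)"
proof -
  let ?A = "{k. k < length xs \<and> k < xs ! k}"
  have "{k. k < length (add_hook xs i j) \<and> k < add_hook xs i j ! k} = insert 0 (Suc ` ?A)"
  proof (rule set_eqI)
    fix k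
    show "k \<in> {k. k < length (add_hook xs i j) \<and> k < add_hook xs i j ! k}
      \<longleftrightarrow> k \<in> insert 0 (Suc ` ?A)"
      \<comment> \<open>Index 0 is the corner of the hook; old diagonal cells move up by one index,
        and the appended ones lie off the diagonal.\<close>
      by (cases k) (auto simp: add_hook_def nth_append)
  qed
  then show ?thesis by (simp add: diagonal_length_def card_image)
qed

lemma is_partition_add_hook:
  assumes "is_partition xs"
  shows "is_partition (add_hook xs i j)"
proof -
  have "x \<le> max_part xs" if "x \<in> set xs" for x
    using assms that by (cases xs) (auto simp: is_partition_def max_part_def)
  then have "\<forall>x\<in>set xs. x \<le> max_part xs + i" by (auto intro: trans_le_add1)
  moreover have "sorted_wrt (\<ge>) (replicate j (1::nat))"
    by (induction j) auto
  ultimately show ?thesis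
    using assms by (auto simp: is_partition_def add_hook_def sorted_wrt_append sorted_wrt_map)
qed

text \<open>Parts are positive, so the entries above 1 after the head are exactly
  \<open>map Suc xs\<close>. Once \<open>xs\<close> is known, the head yields \<open>i\<close> and
  the length yields \<open>j\<close>.\<close>

lemma add_hook_eq_iff:
  assumes "is_partition xs" "is_partition ys"
  shows "add_hook xs i j = add_hook ys k l \<longleftrightarrow> xs = ys \<and> i = k \<and> j = l"
proof
  assume eq: "add_hook xs i j = add_hook ys k l"
  have "map Suc zs = filter (\<lambda>x. 1 < x) (tl (add_hook zs i j))" if "is_partition zs" for zs i j
    using that by (auto simp: add_hook_def is_partition_def filter_map o_def)
  from this[OF assms(1), of i j] this[OF assms(2), of k l] have "map Suc xs = map Suc ys"
    by (simp only: eq)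
  then have "xs = ys" by (simp add: inj_map_eq_map)
  then show "xs = ys \<and> i = k \<and> j = l"
    using eq by (auto simp: add_hook_def)
qed simp

text \<open>This removes the first column: rows of length 1 come last and vanish, all others lose
  one cell.\<close>

lemma is_partition_split_ones:
  assumes "is_partition ys"
  shows "\<exists>xs j. is_partition xs \<and> ys = map Suc xs @ replicate j 1"
  using assms
proof (induction ys)
  case Nil
  have "is_partition []" by (simp add: is_partition_def)
  then show ?case by fastforce
next
  case (Cons y ys)
  then have "is_partition ys" by (simp add: is_partition_def)
  with Cons.IH obtain xs j where xs: "is_partition xs" "ys = map Suc xs @ replicate j 1"
    by blast
  show ?case
  proof (cases "y = 1")
    case True
    then have "\<forall>x\<in>set ys. x \<le> 1"
      using Cons.prems by (simp add: is_partition_def)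
    moreover have "\<forall>x\<in>set xs. 0 < x" using xs(1) by (simp add: is_partition_def)
    ultimately have "xs = []" unfolding xs(2) by (cases xs) simp_all
    then have "y # ys = map Suc [] @ replicate (Suc j) 1" using True xs by simp
    then show ?thesis using xs \<open>xs = []\<close> by blast
  next
    case False
    moreover have "y > 0" using Cons.prems by (simp add: is_partition_def)
    ultimately obtain z where z: "y = Suc z" "z > 0" by (cases y) auto
    have "\<forall>x\<in>set ys. x \<le> y" using Cons.prems by (simp add: is_partition_def)
    then have "is_partition (z # xs)"
      unfolding xs(2) z(1) using xs(1) z(2) by (auto simp: is_partition_def)
    moreover have "y # ys = map Suc (z # xs) @ replicate j 1" using xs(2) z(1) by simp
    ultimately show ?thesis by blast
  qed
qed

lemma is_partition_obtain_add_hook: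
  assumes "ys \<noteq> []" "is_partition ys"
  obtains xs i j where "is_partition xs" "ys = add_hook xs i j"
proof -
  obtain y zs where ys: "ys = y # zs" using assms(1) by (cases ys) auto
  then have y: "\<forall>x\<in>set zs. x \<le> y" "y > 0" and zs: "is_partition zs"
    using assms(2) by (simp_all add: is_partition_def)
  obtain xs j where xs: "is_partition xs" "zs = map Suc xs @ replicate j 1"
    using is_partition_split_ones[OF zs] by blast
  \<comment> \<open>This makes the truncated subtraction giving the overhang of the first row
    exact.\<close>
  have "Suc (max_part xs) \<le> y"
    using y unfolding xs(2) by (cases xs) (simp_all add: max_part_def)
  then have "ys = add_hook xs (y - Suc (max_part xs)) j"
    using ys xs by (simp add: add_hook_def)
  then show thesis using that xs by blast
qed

section \<open>The recurrence from the hook bijection\<close>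

lemma partitions_by_rank_0: "partitions_by_rank 0 m = (if m = 0 then {[]} else {})"
proof -
  have "xs = []" if xs: "is_partition xs" "diagonal_length xs = 0" for xs
  proof (rule ccontr)
    assume "xs \<noteq> []"
    then obtain ys i j where "is_partition ys" "xs = add_hook ys i j"
      using xs(1) by (rule is_partition_obtain_add_hook)
    then show False using xs(2) by (simp add: diagonal_length_add_hook)
  qed
  moreover have "is_partition []" "diagonal_length [] = 0" "semiperimeter [] = 0"
    by (simp_all add: is_partition_def diagonal_length_def semiperimeter_def max_part_def)
  ultimately have "is_partition xs \<and> semiperimeter xs = m \<and> diagonal_length xs = 0
      \<longleftrightarrow> xs = [] \<and> m = 0" for xs
    by metis
  then show ?thesis unfolding partitions_by_rank_def by simp
qed

lemma partitions_by_rank_Suc_small: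
  assumes "m < 2"
  shows "partitions_by_rank (Suc r) m = {}"
proof -
  have False if "xs \<in> partitions_by_rank (Suc r) m" for xs
  proof -
    have xs: "is_partition xs" "semiperimeter xs = m" "diagonal_length xs = Suc r"
      using that by (auto simp: partitions_by_rank_def)
    then have "xs \<noteq> []" by (auto simp: diagonal_length_def)
    then obtain ys i j where "is_partition ys" "xs = add_hook ys i j"
      using xs(1) by (rule is_partition_obtain_add_hook)
    then show False using xs(2) assms by (simp add: semiperimeter_add_hook)
  qed
  then show ?thesis by blast
qed

text \<open>A hook with inner semiperimeter \<open>k\<close> has overhangs of total
  \<open>m - k\<close>, so \<open>i\<close> fixes \<open>j\<close>. Injectivity recovers
  \<open>k\<close> as the semiperimeter of \<open>xs\<close>.\<close>

lemma bij_betw_add_hook: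
  "bij_betw (\<lambda>(k, xs, i). add_hook xs i (m - k - i))
     (SIGMA k:{..m}. partitions_by_rank r k \<times> {..m - k}) (partitions_by_rank (Suc r) (m + 2))"
  unfolding bij_betw_def
proof (intro conjI)
  show "inj_on (\<lambda>(k, xs, i). add_hook xs i (m - k - i))
     (SIGMA k:{..m}. partitions_by_rank r k \<times> {..m - k})"
    by (auto simp: inj_on_def partitions_by_rank_def add_hook_eq_iff)
  show "(\<lambda>(k, xs, i). add_hook xs i (m - k - i)) `
     (SIGMA k:{..m}. partitions_by_rank r k \<times> {..m - k}) = partitions_by_rank (Suc r) (m + 2)"
  proof
    show "partitions_by_rank (Suc r) (m + 2) \<subseteq> (\<lambda>(k, xs, i). add_hook xs i (m - k - i)) `
     (SIGMA k:{..m}. partitions_by_rank r k \<times> {..m - k})"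
    proof
      fix ys assume "ys \<in> partitions_by_rank (Suc r) (m + 2)"
      then have ys: "is_partition ys" "semiperimeter ys = m + 2" "diagonal_length ys = Suc r"
        by (auto simp: partitions_by_rank_def)
      then have "ys \<noteq> []" by (auto simp: diagonal_length_def)
      then obtain xs i j where xs: "is_partition xs" "ys = add_hook xs i j"
        using ys(1) by (rule is_partition_obtain_add_hook)
      then have "semiperimeter xs + i + j = m" "diagonal_length xs = r"
        using ys by (auto simp: semiperimeter_add_hook diagonal_length_add_hook)
      then show "ys \<in> (\<lambda>(k, xs, i). add_hook xs i (m - k - i)) `
          (SIGMA k:{..m}. partitions_by_rank r k \<times> {..m - k})"
        using xs
        by (intro image_eqI[of _ _ "(semiperimeter xs, xs, i)"])
          (auto simp: partitions_by_rank_def)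
    qed
  qed (auto simp: partitions_by_rank_def is_partition_add_hook semiperimeter_add_hook
      diagonal_length_add_hook)
qed

lemma finite_partitions_by_rank: "finite (partitions_by_rank r m)"
proof (induction r arbitrary: m)
  case 0
  then show ?case by (simp add: partitions_by_rank_0)
next
  case (Suc r)
  show ?case
  proof (cases "m < 2")
    case False
    then obtain m' where "m = m' + 2" by (metis add.commute le_Suc_ex not_less)
    then show ?thesis
      using Suc bij_betw_finite[OF bij_betw_add_hook[of m' r]] by simp
  qed (simp add: partitions_by_rank_Suc_small)
qed

lemma card_partitions_by_rank_Suc:
  "card (partitions_by_rank (Suc r) (m + 2))
     = (\<Sum>k\<le>m. card (partitions_by_rank r k) * (m - k + 1))"
  using bij_betw_same_card[OF bij_betw_add_hook[of m r]]
  by (simp add: card_SigmaI finite_partitions_by_rank)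

section \<open>Binomial solution of the recurrence\<close>

lemma sum_choose_mult_diff: "(\<Sum>k<m. (k choose p) * (m - k)) = Suc m choose (p + 2)"
proof (induction m)
  case 0
  then show ?case by simp
next
  case (Suc m)
  have "(\<Sum>k<Suc m. (k choose p) * (Suc m - k))
      = (\<Sum>k<Suc m. (k choose p) * (m - k) + (k choose p))"
    by (intro sum.cong) (auto simp: Suc_diff_le)
  \<comment> \<open>The term \<open>k = m\<close> has weight 0; the second sum is evaluated by the
    hockey-stick identity, and Pascal's rule then finishes.\<close>
  also have "\<dots> = (\<Sum>k<m. (k choose p) * (m - k)) + (\<Sum>k\<le>m. k choose p)"
    by (simp add: sum.distrib lessThan_Suc_atMost[symmetric])
  also have "\<dots> = Suc (Suc m) choose (p + 2)"
    using Suc sum_choose_upper[of p m] by (simp add: atLeast0AtMost)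
  finally show ?case .
qed

text \<open>Each further hook raises the lower binomial index by 2, by
  \<open>sum_choose_mult_diff\<close>. For a single hook only the empty inner partition
  contributes.\<close>

lemma card_partitions_by_rank:
  "card (partitions_by_rank (Suc r) (Suc n)) = n choose (2 * r + 1)"
proof (induction r arbitrary: n)
  case 0
  show ?case
  proof (cases n)
    case 0
    then show ?thesis by (simp add: partitions_by_rank_Suc_small)
  next
    case (Suc m)
    have "card (partitions_by_rank (Suc 0) (m + 2)) = (\<Sum>k\<le>m. if k = 0 then m + 1 else 0)"
      unfolding card_partitions_by_rank_Suc
      by (intro sum.cong) (auto simp: partitions_by_rank_0)
    then show ?thesis using Suc by simp
  qed
next
  case (Suc r)
  show ?case
  proof (cases n)
    case 0
    then show ?thesis by (simp add: partitions_by_rank_Suc_small)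
  next
    case (Suc m)
    have "card (partitions_by_rank (Suc (Suc r)) (m + 2))
        = (\<Sum>k<Suc m. card (partitions_by_rank (Suc r) k) * (m - k + 1))"
      by (simp only: card_partitions_by_rank_Suc lessThan_Suc_atMost)
    \<comment> \<open>No partition of positive rank has semiperimeter 0, so the sum may start at 1,
      which gives the \<open>Suc\<close> form of the induction hypothesis.\<close>
    also have "\<dots> = (\<Sum>k<m. card (partitions_by_rank (Suc r) (Suc k)) * (m - Suc k + 1))"
      by (simp only: sum.lessThan_Suc_shift) (simp add: partitions_by_rank_Suc_small)
    also have "\<dots> = (\<Sum>k<m. (k choose (2 * r + 1)) * (m - k))"
      by (intro sum.cong) (auto simp: Suc.IH Suc_diff_Suc)
    also have "\<dots> = Suc m choose (2 * Suc r + 1)"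
      by (simp add: sum_choose_mult_diff)
    finally show ?thesis using Suc by simp
  qed
qed

theorem theorem5p10:
  fixes n r :: nat
  assumes "n \<ge> 1" and "r \<ge> 1"
  shows "finite {xs. is_partition xs \<and> xs \<noteq> [] \<and> perimeter xs = 2 * n + 2 \<and> durfee_rank xs = r}
     \<and> card {xs. is_partition xs \<and> xs \<noteq> [] \<and> perimeter xs = 2 * n + 2 \<and> durfee_rank xs = r}
           = n choose (2 * r - 1)"
proof -
  obtain s where s: "r = Suc s" using assms(2) by (cases r) auto
  \<comment> \<open>Positive rank excludes \<open>[]\<close>, where \<open>durfee_rank\<close> and
    \<open>diagonal_length\<close> need not agree.\<close>
  have "{xs. is_partition xs \<and> xs \<noteq> [] \<and> perimeter xs = 2 * n + 2 \<and> durfee_rank xs = r}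
      = partitions_by_rank (Suc s) (Suc n)"
    by (auto simp: s partitions_by_rank_def perimeter_def semiperimeter_def max_part_def
        durfee_rank_eq_diagonal_length split: if_splits)
  then show ?thesis
    by (simp add: finite_partitions_by_rank card_partitions_by_rank s)
qed

end
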